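(* Let $K$ be a finite field, let $S=K[t_1,\ldots,t_s]$, let $X\subset K^s$ be a set of points with $|X|\ge 2$, and let $I\subset S$ be the vanishing ideal of $X$. Then $$\mathrm{v}(I)=\min\{\alpha\left((I\colon\mathfrak{p})/I\right) : \mathfrak{p}\in\mathrm{Ass}(I)\},$$ and $\alpha\left((I\colon\mathfrak{p})/I\right)=\mathrm{v}_{\mathfrak{p}}(I)$ for all $\mathfrak{p}\in\mathrm{Ass}(I)$.
   Context: The vanishing ideal of $X$ is the ideal of all polynomials vanishing on $X$. $\mathrm{Ass}(I)$ is the set of associated primes of $S/I$; these are the vanishing ideals of the individual points of $X$. Colon ideals: $(I\colon f)=\{g\in S: gf\in I\}$ for $f\in S$ and $(I\colon\mathfrak{p})=\{g\in S: g\mathfrak{p}\subset I\}$. For $\mathfrak{p}\in\mathrm{Ass}(I)$, $\mathrm{v}_{\mathfrak{p}}(I)=\min\{d\ge 0: \exists\, 0\ne f\in S,\ \deg(f)=d,\ (I\colon f)=\mathfrak{p}\}$. The v-number of $I$ is $\mathrm{v}(I)=\min\{d\ge 0:$ there are $0\ne f\in S$ with $\deg(f)=d$ and $\mathfrak{p}\in\mathrm{Ass}(I)$ with $(I\colon f)=\mathfrak{p}\}$. For an ideal $M\neq 0$ of $S/I$, $\alpha(M)=\min\{\deg(f): f\in S,\ \overline{f}\in M,\ f\notin I\}$, where $\overline{f}=f+I$. *)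

theory Defs
  imports
    "HOL-Library.Poly_Mapping"
    "HOL-Algebra.Algebraic_Closure_Type"
    "HOL-Analysis.Finite_Cartesian_Product"
begin

text \<open>
  The polynomial ring \<open>K[t\<^sub>1,\<dots>,t\<^sub>s]\<close> is the type of finitely supported maps from exponent vectors to
  coefficients, with the convolution product of \<^theory>\<open>HOL-Library.Poly_Mapping\<close>; the variables are
  indexed by a finite type, so \<open>s = CARD('n)\<close>.  \<open>K\<^sup>s\<close> is \<open>'k ^ 'n\<close>.
\<close>

type_synonym ('n, 'k) mpoly = "('n \<Rightarrow>\<^sub>0 nat) \<Rightarrow>\<^sub>0 'k"

definition mpoly_eval :: "('n::finite, 'k::comm_ring_1) mpoly \<Rightarrow> 'k ^ 'n \<Rightarrow> 'k" where
  "mpoly_eval f x =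
     (\<Sum>m\<in>Poly_Mapping.keys f.
        Poly_Mapping.lookup f m * (\<Prod>i\<in>UNIV. (x $ i) ^ Poly_Mapping.lookup m i))"

text \<open>Total degree, with the value \<open>0\<close> at the zero polynomial.\<close>

definition total_degree :: "('n::finite, 'k::zero) mpoly \<Rightarrow> nat" where
  "total_degree f =
     Max (insert 0 ((\<lambda>m. \<Sum>i\<in>UNIV. Poly_Mapping.lookup m i) ` Poly_Mapping.keys f))"

definition vanishing_ideal :: "('k::comm_ring_1 ^ 'n::finite) set \<Rightarrow> ('n, 'k) mpoly set" where
  "vanishing_ideal \<X> = {f. \<forall>x\<in>\<X>. mpoly_eval f x = 0}"

definition colon_elem :: "'a::comm_ring_1 set \<Rightarrow> 'a \<Rightarrow> 'a set" where
  "colon_elem I f = {g. g * f \<in> I}"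

definition colon_ideal :: "'a::comm_ring_1 set \<Rightarrow> 'a set \<Rightarrow> 'a set" where
  "colon_ideal I J = {g. \<forall>h\<in>J. g * h \<in> I}"

abbreviation quot_ring :: "'a::comm_ring_1 set \<Rightarrow> 'a set ring" where
  "quot_ring I \<equiv> ring_of_type_algebra Quot I"

abbreviation residue_class :: "'a::comm_ring_1 set \<Rightarrow> 'a \<Rightarrow> 'a set" where
  "residue_class I f \<equiv> I +>\<^bsub>ring_of_type_algebra\<^esub> f"

text \<open>The ideal \<open>J/I\<close> of the quotient ring, for an ideal \<open>J \<supseteq> I\<close>.\<close>

definition quot_ideal :: "'a::comm_ring_1 set \<Rightarrow> 'a set \<Rightarrow> 'a set set" where
  "quot_ideal J I = residue_class I ` J"

text \<open>
  Associated primes of the module \<open>S/I\<close>: the prime ideals of \<open>S\<close> that are the annihilator of some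
  element \<open>m\<close> of \<open>S/I\<close>, where \<open>g \<in> S\<close> acts on \<open>S/I\<close> as multiplication by its residue class.
\<close>

definition Ass :: "'a::comm_ring_1 set \<Rightarrow> 'a set set" where
  "Ass I = {p. primeideal p ring_of_type_algebra \<and>
     (\<exists>m\<in>carrier (quot_ring I).
        p = {g. residue_class I g \<otimes>\<^bsub>quot_ring I\<^esub> m = \<zero>\<^bsub>quot_ring I\<^esub>})}"

definition v_local :: "('n::finite, 'k::comm_ring_1) mpoly set \<Rightarrow> ('n, 'k) mpoly set \<Rightarrow> nat" where
  "v_local I p = (LEAST d. \<exists>f. f \<noteq> 0 \<and> total_degree f = d \<and> colon_elem I f = p)"

definition v_number :: "('n::finite, 'k::comm_ring_1) mpoly set \<Rightarrow> nat" where
  "v_number I =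
     (LEAST d. \<exists>f. f \<noteq> 0 \<and> total_degree f = d \<and> (\<exists>p\<in>Ass I. colon_elem I f = p))"

text \<open>\<open>\<alpha>(M)\<close> for a nonzero ideal \<open>M\<close> of \<open>S/I\<close>; a junk value if \<open>M\<close> is the zero ideal.\<close>

definition alpha :: "('n::finite, 'k::comm_ring_1) mpoly set \<Rightarrow> ('n, 'k) mpoly set set \<Rightarrow> nat" where
  "alpha I M = (LEAST d. \<exists>f. residue_class I f \<in> M \<and> f \<notin> I \<and> total_degree f = d)"

end

theory Submission
  imports Defs
begin

text \<open>
  Let \<open>q = |K|\<close>.  Both assertions follow from one equivalence, for an
  associated prime \<open>\<pp>\<close> of \<open>I\<close>: \<open>(I : f) = \<pp>\<close> holds if and only if \<open>f\<close> lies in \<open>(I : \<pp>)\<close> but not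
  in \<open>I\<close> (\<open>colon_elem_eq_Ass_iff\<close>).  It says that \<open>v_local I \<pp>\<close> and the \<open>\<alpha>\<close>-invariant of
  \<open>(I : \<pp>)/I\<close> minimise the degree over the same set of polynomials; the v-number minimises it over
  the union of these sets, which is the least of the individual minima.

  From left to right, \<open>f \<notin> I\<close> because \<open>\<pp>\<close> is proper.  Conversely, if \<open>f \<pp> \<subseteq> I\<close> and
  \<open>f \<notin> I\<close>, then \<open>(I : f)\<close> is a proper ideal that contains \<open>\<pp>\<close>, so it suffices that \<open>\<pp>\<close> is maximal.
  This comes from Fermat's identity \<open>a\<^sup>q = a\<close> in \<open>K\<close>: every polynomial \<open>g (1 - g\<^bsup>q-1\<^esup>)\<close> vanishes
  on all of \<open>K\<^sup>s\<close>, hence lies in \<open>\<pp>\<close>, so every \<open>g \<notin> \<pp>\<close> is invertible modulo \<open>\<pp>\<close>.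

  That \<open>I\<close> has an associated prime is seen by taking a polynomial \<open>f \<notin> I\<close> that is nonzero at as few
  points of \<open>\<X>\<close> as possible.  If \<open>g f \<notin> I\<close>, then \<open>g f\<close> is nonzero at the same points as \<open>f\<close>, so
  that \<open>h g f \<in> I\<close> forces \<open>h f \<in> I\<close>; thus \<open>(I : f)\<close> is prime.
\<close>


section \<open>Evaluation is a ring homomorphism\<close>

lemma mpoly_eval_superset:
  assumes "finite A" "Poly_Mapping.keys f \<subseteq> A"
  shows "mpoly_eval f x =
    (\<Sum>m\<in>A. Poly_Mapping.lookup f m * (\<Prod>i\<in>UNIV. (x $ i) ^ Poly_Mapping.lookup m i))"
  unfolding mpoly_eval_def
  by (rule sum.mono_neutral_left) (use assms in \<open>auto simp: in_keys_iff\<close>)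

lemma mpoly_eval_0 [simp]: "mpoly_eval 0 x = 0"
  by (simp add: mpoly_eval_def)

lemma mpoly_eval_single:
  "mpoly_eval (Poly_Mapping.single m c) x = c * (\<Prod>i\<in>UNIV. (x $ i) ^ Poly_Mapping.lookup m i)"
  by (subst mpoly_eval_superset[of "{m}"]) auto

lemma mpoly_eval_1 [simp]: "mpoly_eval 1 x = 1"
  by (simp add: mpoly_eval_single flip: single_one)

lemma mpoly_eval_add: "mpoly_eval (f + g) x = mpoly_eval f x + mpoly_eval g x"
proof -
  let ?A = "Poly_Mapping.keys f \<union> Poly_Mapping.keys g"
  have "Poly_Mapping.keys (f + g) \<subseteq> ?A"
    by (rule keys_add)
  then show ?thesis
    by (simp add: mpoly_eval_superset[of ?A] lookup_add distrib_right sum.distrib)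
qed

lemma mpoly_eval_uminus: "mpoly_eval (- f) x = - mpoly_eval f x"
  using mpoly_eval_add[of f "- f" x] by (simp add: minus_unique)

lemma mpoly_eval_diff: "mpoly_eval (f - g) x = mpoly_eval f x - mpoly_eval g x"
  using mpoly_eval_add[of f "- g" x] by (simp add: mpoly_eval_uminus)

lemma mpoly_eval_sum: "mpoly_eval (\<Sum>a\<in>A. F a) x = (\<Sum>a\<in>A. mpoly_eval (F a) x)"
  by (induction A rule: infinite_finite_induct) (auto simp: mpoly_eval_add)

lemma poly_mapping_eq_sum_single:
  "f = (\<Sum>m\<in>Poly_Mapping.keys f. Poly_Mapping.single m (Poly_Mapping.lookup f m))"
proof (rule poly_mapping_eqI)
  fix k
  show "Poly_Mapping.lookup f k = Poly_Mapping.lookup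
      (\<Sum>m\<in>Poly_Mapping.keys f. Poly_Mapping.single m (Poly_Mapping.lookup f m)) k"
    by (simp add: lookup_sum lookup_single when_def in_keys_iff)
qed

lemma mpoly_eval_mult: "mpoly_eval (f * g) x = mpoly_eval f x * mpoly_eval g x"
proof -
  let ?s = "\<lambda>f m. Poly_Mapping.single m (Poly_Mapping.lookup f m)"
  have "mpoly_eval (f * g) x =
      mpoly_eval ((\<Sum>m\<in>Poly_Mapping.keys f. ?s f m) * (\<Sum>n\<in>Poly_Mapping.keys g. ?s g n)) x"
    by (simp only: poly_mapping_eq_sum_single[symmetric])
  also have "\<dots> = (\<Sum>m\<in>Poly_Mapping.keys f. \<Sum>n\<in>Poly_Mapping.keys g.
      mpoly_eval (?s f m) x * mpoly_eval (?s g n) x)"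
    unfolding sum_product mpoly_eval_sum mult_single mpoly_eval_single
    by (simp add: lookup_add power_add prod.distrib mult_ac)
  also have "\<dots> = mpoly_eval (\<Sum>m\<in>Poly_Mapping.keys f. ?s f m) x *
      mpoly_eval (\<Sum>n\<in>Poly_Mapping.keys g. ?s g n) x"
    unfolding sum_product mpoly_eval_sum ..
  also have "\<dots> = mpoly_eval f x * mpoly_eval g x"
    by (simp only: poly_mapping_eq_sum_single[symmetric])
  finally show ?thesis .
qed

lemma mpoly_eval_power: "mpoly_eval (f ^ n) x = mpoly_eval f x ^ n"
  by (induction n) (simp_all add: mpoly_eval_mult)


section \<open>Ideals, cosets and colon ideals in type-class rings\<close>

abbreviation is_ideal :: "'a::comm_ring_1 set \<Rightarrow> bool" where
  "is_ideal I \<equiv> ideal I ring_of_type_algebra"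

lemma ring_of_type_algebra_simps [simp]:
  "carrier ring_of_type_algebra = UNIV"
  "x \<otimes>\<^bsub>ring_of_type_algebra\<^esub> y = x * y"
  "x \<oplus>\<^bsub>ring_of_type_algebra\<^esub> y = x + y"
  "\<zero>\<^bsub>ring_of_type_algebra\<^esub> = 0"
  "\<one>\<^bsub>ring_of_type_algebra\<^esub> = 1"
  by (auto simp: ring_of_type_algebra_def)

lemma is_idealI:
  fixes I :: "'a::comm_ring_1 set"
  assumes zero: "0 \<in> I" and add: "\<And>a b. a \<in> I \<Longrightarrow> b \<in> I \<Longrightarrow> a + b \<in> I"
    and mult: "\<And>a r. a \<in> I \<Longrightarrow> r * a \<in> I"
  shows "is_ideal I"
proof -
  interpret R: cring "ring_of_type_algebra :: 'a ring"
    by (rule cring_from_type_algebra)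
  show ?thesis
  proof (rule idealI)
    show "ring (ring_of_type_algebra :: 'a ring)"
      by (rule R.ring_axioms)
    show "subgroup I (add_monoid (ring_of_type_algebra :: 'a ring))"
    proof (rule R.add.subgroupI)
      fix a assume "a \<in> I"
      have "\<ominus>\<^bsub>ring_of_type_algebra\<^esub> a = - a"
        using R.minus_equality[of "- a" a] by simp
      with mult[OF \<open>a \<in> I\<close>, of "- 1"]
      show "\<ominus>\<^bsub>ring_of_type_algebra\<^esub> a \<in> I" by simp
    qed (use zero add in auto)
    fix a x assume "a \<in> I"
    then show "x \<otimes>\<^bsub>ring_of_type_algebra\<^esub> a \<in> I" "a \<otimes>\<^bsub>ring_of_type_algebra\<^esub> x \<in> I"
      using mult[of a x] by (simp_all add: mult.commute)
  qed
qed

lemma is_idealD: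
  assumes "is_ideal I"
  shows "0 \<in> I" and "a \<in> I \<Longrightarrow> b \<in> I \<Longrightarrow> a + b \<in> I"
    and "a \<in> I \<Longrightarrow> r * a \<in> I" and "a \<in> I \<Longrightarrow> a * r \<in> I" and "a \<in> I \<Longrightarrow> - a \<in> I"
proof -
  interpret ideal I ring_of_type_algebra by (rule assms)
  show "0 \<in> I"
    using additive_subgroup.zero_closed[OF is_additive_subgroup] by simp
  show "a \<in> I \<Longrightarrow> b \<in> I \<Longrightarrow> a + b \<in> I"
    using additive_subgroup.a_closed[OF is_additive_subgroup, of a b] by simp
  show "a \<in> I \<Longrightarrow> r * a \<in> I" "a \<in> I \<Longrightarrow> a * r \<in> I" "a \<in> I \<Longrightarrow> - a \<in> I"
    using I_l_closed[of a r] I_r_closed[of a r] I_l_closed[of a "- 1"] by simp_all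
qed

lemma residue_class_eq: "residue_class I f = (\<lambda>h. h + f) ` I"
  by (auto simp: a_r_coset_def')

lemma residue_class_eq_iff:
  assumes "is_ideal I"
  shows "residue_class I f = residue_class I g \<longleftrightarrow> f - g \<in> I"
proof
  assume "residue_class I f = residue_class I g"
  moreover have "f \<in> residue_class I f"
    using is_idealD(1)[OF assms] by (force simp: residue_class_eq)
  ultimately obtain h where "h \<in> I" "f = h + g"
    by (auto simp: residue_class_eq)
  then show "f - g \<in> I" by simp
next
  have shift: "residue_class I f \<subseteq> residue_class I g" if "f - g \<in> I" for f g
  proof
    fix y assume "y \<in> residue_class I f"
    then obtain h where "h \<in> I" "y = (h + (f - g)) + g"
      by (auto simp: residue_class_eq)
    moreover from that \<open>h \<in> I\<close> have "h + (f - g) \<in> I"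
      by (intro is_idealD(2)[OF assms])
    ultimately show "y \<in> residue_class I g"
      unfolding residue_class_eq by blast
  qed
  assume "f - g \<in> I"
  then show "residue_class I f = residue_class I g"
    using shift[of f g] shift[of g f] is_idealD(5)[OF assms, of "f - g"] by auto
qed

lemma zero_quot_ring: "\<zero>\<^bsub>quot_ring I\<^esub> = I"
  by (simp add: FactRing_def)

lemma residue_class_eq_zero_iff:
  assumes "is_ideal I"
  shows "residue_class I f = \<zero>\<^bsub>quot_ring I\<^esub> \<longleftrightarrow> f \<in> I"
  using residue_class_eq_iff[OF assms, of f 0] by (simp add: zero_quot_ring residue_class_eq)

text \<open>
  An element whose class lies in \<open>J/I\<close> is itself in \<open>J\<close>, because \<open>J\<close> is a union of cosets of \<open>I\<close>.
\<close>

lemma residue_class_in_quot_ideal_iff: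
  assumes "is_ideal I" "is_ideal J" "I \<subseteq> J"
  shows "residue_class I f \<in> quot_ideal J I \<longleftrightarrow> f \<in> J"
proof
  assume "residue_class I f \<in> quot_ideal J I"
  then obtain g where g: "g \<in> J" "f - g \<in> I"
    by (auto simp: quot_ideal_def residue_class_eq_iff[OF assms(1)])
  then have "(f - g) + g \<in> J"
    using assms(3) by (intro is_idealD(2)[OF assms(2)]) auto
  then show "f \<in> J" by simp
qed (simp add: quot_ideal_def)

lemma is_ideal_colon_ideal:
  assumes "is_ideal I"
  shows "is_ideal (colon_ideal I J)"
  by (rule is_idealI)
     (auto simp: colon_ideal_def distrib_right mult.assoc intro: is_idealD[OF assms])

lemma colon_elem_eq_colon_ideal: "colon_elem I f = colon_ideal I {f}"
  by (simp add: colon_elem_def colon_ideal_def)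

lemma subset_colon_ideal:
  assumes "is_ideal I"
  shows "I \<subseteq> colon_ideal I J"
  by (auto simp: colon_ideal_def intro: is_idealD[OF assms])

lemma is_prime_iff:
  assumes "is_ideal p"
  shows "primeideal p ring_of_type_algebra \<longleftrightarrow>
    1 \<notin> p \<and> (\<forall>a b. a * b \<in> p \<longrightarrow> a \<in> p \<or> b \<in> p)"
proof -
  have "1 \<in> p \<longleftrightarrow> p = UNIV"
    using is_idealD(3)[OF assms, of 1] by auto
  then show ?thesis
    using assms primeideal.I_prime[of p ring_of_type_algebra]
      primeideal.I_notcarr[of p ring_of_type_algebra]
      primeidealI[OF assms cring_from_type_algebra]
    by auto
qed

lemma Ass_iff:
  assumes "is_ideal I"
  shows "p \<in> Ass I \<longleftrightarrow> primeideal p ring_of_type_algebra \<and> (\<exists>f. p = colon_elem I f)"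
proof -
  have "carrier (quot_ring I) = range (residue_class I)"
    by (auto simp: FactRing_def A_RCOSETS_def')
  moreover have
    "{g. residue_class I g \<otimes>\<^bsub>quot_ring I\<^esub> residue_class I f = \<zero>\<^bsub>quot_ring I\<^esub>} = colon_elem I f" for f
  proof -
    have "residue_class I g \<otimes>\<^bsub>quot_ring I\<^esub> residue_class I f = residue_class I (g * f)" for g
      using ideal.rcoset_mult_add[OF assms, of g f] by (simp add: FactRing_def)
    then show ?thesis
      by (simp add: colon_elem_def residue_class_eq_zero_iff[OF assms])
  qed
  ultimately show ?thesis
    by (auto simp: Ass_def)
qed


section \<open>Ideals modulo which every element is potent\<close>

text \<open>
  The hypothesis on \<open>I\<close> makes each \<open>g \<notin> \<pp>\<close> a unit modulo the prime \<open>\<pp>\<close>: from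
  \<open>g (1 - g\<^sup>n) \<in> I \<subseteq> \<pp>\<close> one gets \<open>1 - g\<^sup>n \<in> \<pp>\<close>.  An ideal that strictly contains \<open>\<pp>\<close> therefore
  contains \<open>1\<close>.
\<close>

lemma prime_over_potent_ideal_maximal:
  assumes potent: "\<And>g. \<exists>n>0. g * (1 - g ^ n) \<in> I"
    and "primeideal p ring_of_type_algebra" and "I \<subseteq> p"
    and J: "is_ideal J" "p \<subseteq> J" "1 \<notin> J"
  shows "J = p"
proof (rule ccontr)
  assume "J \<noteq> p"
  then obtain g where g: "g \<in> J" "g \<notin> p"
    using J(2) by auto
  obtain n where n: "n > 0" "g * (1 - g ^ n) \<in> I"
    using potent by blast
  have "1 - g ^ n \<in> p"
    using primeideal.I_prime[OF assms(2), of g "1 - g ^ n"] g n \<open>I \<subseteq> p\<close> by auto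
  moreover have "g ^ n \<in> J"
    using is_idealD(4)[OF J(1) g(1), of "g ^ (n - 1)"] n(1) by (simp add: power_eq_if)
  ultimately have "(1 - g ^ n) + g ^ n \<in> J"
    using J(2) by (intro is_idealD(2)[OF J(1)]) auto
  with J(3) show False by simp
qed

text \<open>
  This turns the condition \<open>(I : f) = \<pp>\<close>, over which the v-number minimises, into membership of the
  class of \<open>f\<close> in \<open>(I : \<pp>)/I\<close>, over which \<open>\<alpha>\<close> minimises.
\<close>

lemma colon_elem_eq_Ass_iff:
  assumes I: "is_ideal I" and potent: "\<And>g. \<exists>n>0. g * (1 - g ^ n) \<in> I"
    and p: "p \<in> Ass I"
  shows "colon_elem I f = p \<longleftrightarrow> f \<in> colon_ideal I p \<and> f \<notin> I"
proof -
  have prime: "primeideal p ring_of_type_algebra"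
    using p by (simp add: Ass_iff[OF I])
  then have "is_ideal p"
    by (simp add: primeideal_def)
  have in_colon: "f \<in> colon_ideal I p \<longleftrightarrow> p \<subseteq> colon_elem I f"
    by (auto simp: colon_elem_def colon_ideal_def mult.commute)
  have proper: "f \<notin> I \<longleftrightarrow> 1 \<notin> colon_elem I f"
    by (simp add: colon_elem_def)
  have "I \<subseteq> p"
    using p by (auto simp: Ass_iff[OF I] colon_elem_def intro: is_idealD[OF I])
  show ?thesis
  proof
    assume "colon_elem I f = p"
    moreover have "1 \<notin> p"
      using prime is_prime_iff[OF \<open>is_ideal p\<close>] by blast
    ultimately show "f \<in> colon_ideal I p \<and> f \<notin> I"
      using in_colon proper by auto
  next
    assume "f \<in> colon_ideal I p \<and> f \<notin> I"
    then show "colon_elem I f = p"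
      using in_colon proper is_ideal_colon_ideal[OF I, of "{f}"]
        prime_over_potent_ideal_maximal[OF potent prime \<open>I \<subseteq> p\<close>]
      by (simp add: colon_elem_eq_colon_ideal)
  qed
qed


section \<open>Vanishing ideals over a finite field\<close>

lemma is_ideal_vanishing_ideal: "is_ideal (vanishing_ideal \<X>)"
  by (rule is_idealI) (auto simp: vanishing_ideal_def mpoly_eval_add mpoly_eval_mult)

text \<open>
  Multiplication by a nonzero element permutes the nonzero elements and hence leaves their product
  unchanged.
\<close>

lemma finite_field_fermat:
  fixes a :: "'k::{field,finite}"
  assumes "a \<noteq> 0"
  shows "a ^ card (UNIV - {0 :: 'k}) = 1"
proof -
  let ?U = "UNIV - {0 :: 'k}"
  have "bij_betw ((*) a) ?U ?U"
    by (rule bij_betwI[where g = "\<lambda>y. y / a"]) (use assms in auto)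
  then have "(\<Prod>y\<in>?U. y) = (\<Prod>y\<in>?U. a * y)"
    by (rule prod.reindex_bij_betw[symmetric])
  also have "\<dots> = a ^ card ?U * (\<Prod>y\<in>?U. y)"
    by (simp add: prod.distrib)
  finally show ?thesis
    by simp
qed

lemma vanishing_ideal_potent:
  fixes \<X> :: "('k::{field,finite} ^ 'n::finite) set"
  shows "\<exists>n>0. g * (1 - g ^ n) \<in> vanishing_ideal \<X>"
proof (intro exI conjI)
  have "(1 :: 'k) \<in> UNIV - {0}"
    by simp
  then show "card (UNIV - {0 :: 'k}) > 0"
    by (metis card_gt_0_iff empty_iff finite)
  show "g * (1 - g ^ card (UNIV - {0 :: 'k})) \<in> vanishing_ideal \<X>"
    using finite_field_fermat[of "mpoly_eval g _"]
    by (auto simp: vanishing_ideal_def mpoly_eval_mult mpoly_eval_diff mpoly_eval_power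
        simp del: card_Diff_insert card_Diff_singleton)
qed

text \<open>
  A polynomial with the smallest possible nonempty support on \<open>\<X>\<close> has a prime annihilator modulo the
  vanishing ideal: multiplying it by \<open>g\<close> either kills it or leaves its support unchanged.
\<close>

lemma Ass_vanishing_ideal_nonempty:
  fixes \<X> :: "('k::field ^ 'n::finite) set"
  assumes "finite \<X>" "\<X> \<noteq> {}"
  shows "Ass (vanishing_ideal \<X>) \<noteq> {}"
proof -
  let ?I = "vanishing_ideal \<X>"
  define supp where "supp f = {x \<in> \<X>. mpoly_eval f x \<noteq> 0}" for f
  have in_I_iff: "f \<in> ?I \<longleftrightarrow> supp f = {}" for f
    by (auto simp: vanishing_ideal_def supp_def)
  have supp_mult: "supp (f * g) = supp f \<inter> supp g" for f g
    by (auto simp: supp_def mpoly_eval_mult)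
  have "supp 1 \<noteq> {}"
    using assms(2) by (simp add: supp_def)
  then obtain f where f: "supp f \<noteq> {}"
    and min: "\<And>g. supp g \<noteq> {} \<Longrightarrow> card (supp f) \<le> card (supp g)"
    using ex_has_least_nat[of "\<lambda>f. supp f \<noteq> {}" 1 "\<lambda>f. card (supp f)"] by blast
  have fin: "finite (supp f)"
    using assms(1) by (simp add: supp_def)
  have "h \<in> colon_elem ?I f" if "g * h \<in> colon_elem ?I f" "g \<notin> colon_elem ?I f" for g h
  proof -
    have "supp (g * f) \<noteq> {}"
      using that by (simp add: colon_elem_def in_I_iff)
    then have "supp (g * f) = supp f"
      by (intro card_seteq[OF fin] min) (auto simp: supp_mult)
    with that show ?thesis
      by (auto simp: colon_elem_def in_I_iff supp_mult)
  qed
  moreover have "is_ideal (colon_elem ?I f)"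
    by (simp add: colon_elem_eq_colon_ideal is_ideal_colon_ideal is_ideal_vanishing_ideal)
  moreover have "1 \<notin> colon_elem ?I f"
    using f by (simp add: colon_elem_def in_I_iff)
  ultimately have "primeideal (colon_elem ?I f) ring_of_type_algebra"
    by (auto simp: is_prime_iff)
  then show ?thesis
    using Ass_iff[OF is_ideal_vanishing_ideal] by blast
qed


section \<open>The v-number and initial degrees of colon ideals\<close>

lemma Least_eq_Least_of_Leasts:
  fixes P :: "'a \<Rightarrow> nat \<Rightarrow> bool"
  assumes nonempty: "A \<noteq> {}" and witness: "\<And>a. a \<in> A \<Longrightarrow> \<exists>d. P a d"
  shows "(LEAST d. \<exists>a\<in>A. P a d) = (LEAST d. \<exists>a\<in>A. d = (LEAST e. P a e))"
proof (rule antisym)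
  have "\<exists>d. \<exists>a\<in>A. d = (LEAST e. P a e)"
    using nonempty by auto
  from LeastI_ex[OF this] obtain a
    where a: "a \<in> A" "(LEAST d. \<exists>a\<in>A. d = (LEAST e. P a e)) = (LEAST e. P a e)"
    by blast
  then have "P a (LEAST e. P a e)"
    using witness by (blast intro: LeastI_ex)
  then show "(LEAST d. \<exists>a\<in>A. P a d) \<le> (LEAST d. \<exists>a\<in>A. d = (LEAST e. P a e))"
    unfolding a(2) using a(1) by (blast intro: Least_le)
next
  have "\<exists>d. \<exists>a\<in>A. P a d"
    using nonempty witness by blast
  from LeastI_ex[OF this] obtain a where a: "a \<in> A" "P a (LEAST d. \<exists>a\<in>A. P a d)"
    by blast
  have "(LEAST d. \<exists>a\<in>A. d = (LEAST e. P a e)) \<le> (LEAST e. P a e)"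
    using a(1) by (blast intro: Least_le)
  also have "\<dots> \<le> (LEAST d. \<exists>a\<in>A. P a d)"
    using a(2) by (rule Least_le)
  finally show "(LEAST d. \<exists>a\<in>A. d = (LEAST e. P a e)) \<le> (LEAST d. \<exists>a\<in>A. P a d)" .
qed

theorem proposition4p5:
  fixes \<X> :: "('k::{field,finite} ^ 'n::finite) set"
    and I :: "('n, 'k) mpoly set"
  assumes "card \<X> \<ge> 2"
    and "I = vanishing_ideal \<X>"
  shows "Ass I \<noteq> {} \<and>
    v_number I = (LEAST d. \<exists>p\<in>Ass I. d = alpha I (quot_ideal (colon_ideal I p) I)) \<and>
    (\<forall>p\<in>Ass I. quot_ideal (colon_ideal I p) I \<noteq> {\<zero>\<^bsub>quot_ring I\<^esub>} \<and>
       alpha I (quot_ideal (colon_ideal I p) I) = v_local I p)"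
proof -
  have I: "is_ideal I"
    using assms(2) by (simp add: is_ideal_vanishing_ideal)
  have potent: "\<exists>n>0. g * (1 - g ^ n) \<in> I" for g
    using assms(2) by (simp add: vanishing_ideal_potent)
  have "finite \<X>" "\<X> \<noteq> {}"
    using assms(1) by (auto simp: card_gt_0_iff intro: card_ge_0_finite)
  then have nonempty: "Ass I \<noteq> {}"
    using assms(2) by (simp add: Ass_vanishing_ideal_nonempty)

  have colon_iff: "residue_class I f \<in> quot_ideal (colon_ideal I p) I \<and> f \<notin> I \<longleftrightarrow>
      colon_elem I f = p" if "p \<in> Ass I" for f p
    using residue_class_in_quot_ideal_iff[OF I is_ideal_colon_ideal[OF I] subset_colon_ideal[OF I]]
      colon_elem_eq_Ass_iff[OF I potent that]
    by blast
  have nonzero: "f \<noteq> 0" if "p \<in> Ass I" "colon_elem I f = p" for f p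
    using colon_iff[OF that(1)] that(2) is_idealD(1)[OF I] by blast

  have alpha: "alpha I (quot_ideal (colon_ideal I p) I) = v_local I p" if "p \<in> Ass I" for p
  proof -
    have "(\<exists>f. residue_class I f \<in> quot_ideal (colon_ideal I p) I \<and> f \<notin> I \<and> total_degree f = d)
        \<longleftrightarrow> (\<exists>f. f \<noteq> 0 \<and> total_degree f = d \<and> colon_elem I f = p)" for d
      using colon_iff[OF that] nonzero[OF that] by blast
    then show ?thesis
      by (simp add: alpha_def v_local_def)
  qed
  have witness: "\<exists>f. f \<noteq> 0 \<and> colon_elem I f = p" if "p \<in> Ass I" for p
  proof -
    obtain f where "colon_elem I f = p"
      using \<open>p \<in> Ass I\<close> by (auto simp: Ass_iff[OF I])
    with nonzero[OF \<open>p \<in> Ass I\<close>] show ?thesis by blast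
  qed
  have nontrivial: "quot_ideal (colon_ideal I p) I \<noteq> {\<zero>\<^bsub>quot_ring I\<^esub>}" if "p \<in> Ass I" for p
  proof -
    obtain f where "colon_elem I f = p"
      using witness[OF \<open>p \<in> Ass I\<close>] by blast
    then have "residue_class I f \<in> quot_ideal (colon_ideal I p) I"
      and "residue_class I f \<noteq> \<zero>\<^bsub>quot_ring I\<^esub>"
      using colon_iff[OF \<open>p \<in> Ass I\<close>, of f] by (simp_all add: residue_class_eq_zero_iff[OF I])
    then show ?thesis by blast
  qed

  have "v_number I =
      (LEAST d. \<exists>p\<in>Ass I. \<exists>f. f \<noteq> 0 \<and> total_degree f = d \<and> colon_elem I f = p)"
    unfolding v_number_def by (rule arg_cong[where f = Least]) blast
  also have "\<dots> = (LEAST d. \<exists>p\<in>Ass I. d = v_local I p)"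
    unfolding v_local_def using nonempty
    by (rule Least_eq_Least_of_Leasts) (use witness in blast)
  also have "\<dots> = (LEAST d. \<exists>p\<in>Ass I. d = alpha I (quot_ideal (colon_ideal I p) I))"
    using alpha by simp
  finally show ?thesis
    using nonempty alpha nontrivial by blast
qed

end
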